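(* Let $\mathbf e$ be an infinite timed stream, and let $(\psi_j)$ be a finite or infinite sequence of specification versions in $\Psi$ with activation indices $0=n_0<n_1<n_2<\cdots$. Let an obligation originate at index $k$ under $\psi_j$, i.e. $n_j\le k<n_{j+1}$. Under origin-version semantics, its trigger status (whether $\mathbf e,k\models\operatorname{trig}(\psi_j)$), its outcome $X_k^{\psi_j}$, and its completion index $$c_{\psi_j}(k):=\min\{m\ge k:\ t_m>t_k+H(\psi_j)\}$$ depend only on $(\mathbf e,k,\psi_j)$ and are unaffected by subsequent revisions: any two activation histories over the same stream $\mathbf e$ that assign the same version to the origin $k$ give the same trigger status, outcome and completion index for the obligation originating at $k$. Moreover, for every origin index $k\in\mathbb N$, there exists exactly one $j$ such that $n_j\le k<n_{j+1}$. Consequently, the obligation originating at $k$ is assigned to $\psi_j$, independently of when it completes.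
   Context: Timed streams. Let $\mathcal{AP}$ be a finite set of atomic propositions. An infinite timed stream is a sequence $\mathbf e=e_0e_1e_2\cdots$ with $e_n=(t_n,\nu_n)$, $t_n\in\mathbb R_{\ge0}$, $\nu_n\subseteq\mathcal{AP}$, $t_n\le t_{n+1}$ for all $n$, and $\lim_{n\to\infty}t_n=\infty$ (non-Zeno). Formulas. $\Phi$ is the set of formulas generated by $\varphi::=p\mid\top\mid\bot\mid\neg\varphi\mid\varphi\land\varphi\mid\varphi\lor\varphi\mid\Box_{[a,b]}\varphi\mid\Diamond_{[a,b]}\varphi$ with $p\in\mathcal{AP}$, $0\le a\le b<\infty$. Satisfaction: $\mathbf e,n\models p$ iff $p\in\nu_n$; $\top$ always holds, $\bot$ never; Boolean connectives as usual; $\mathbf e,n\models\Box_{[a,b]}\varphi$ iff for all $m\ge n$ with $t_m-t_n\in[a,b]$, $\mathbf e,m\models\varphi$; $\mathbf e,n\models\Diamond_{[a,b]}\varphi$ iff there is $m\ge n$ with $t_m-t_n\in[a,b]$ and $\mathbf e,m\models\varphi$. Structural horizon: $\operatorname{hzn}(p)=\operatorname{hzn}(\top)=\operatorname{hzn}(\bot)=0$, $\operatorname{hzn}(\neg\varphi)=\operatorname{hzn}(\varphi)$, $\operatorname{hzn}(\varphi_1\circ\varphi_2)=\max\{\operatorname{hzn}(\varphi_1),\operatorname{hzn}(\varphi_2)\}$ for $\circ\in\{\land,\lor\}$, $\operatorname{hzn}(\Box_{[a,b]}\varphi)=\operatorname{hzn}(\Diamond_{[a,b]}\varphi)=b+\operatorname{hzn}(\varphi)$.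 Specifications. A parameter envelope $\mathcal A_{\mathrm{par}}\subseteq\{(\lambda,a,b)\in[0,1]\times\mathbb R_{\ge0}^2: 0\le a\le b<\infty\}$ is fixed. A specification is a tuple $\psi=(\varphi_1^{\mathrm{core}},\varphi_1^{\mathrm{adapt}},\varphi_2^{\mathrm{core}},\varphi_2^{\mathrm{adapt}},\lambda,a,b)$ with the four formulas in $\Phi$ and $(\lambda,a,b)\in\mathcal A_{\mathrm{par}}$; $\Psi$ is the set of such tuples. $\operatorname{trig}(\psi)=\varphi_1^{\mathrm{core}}\lor\varphi_1^{\mathrm{adapt}}$, $\operatorname{resp}(\psi)=\varphi_2^{\mathrm{core}}\land\varphi_2^{\mathrm{adapt}}$. Observation horizon: $H(\psi)=\max\{\operatorname{hzn}(\operatorname{trig}(\psi)),\ b+\operatorname{hzn}(\operatorname{resp}(\psi))\}$. Outcome. For a specification $\psi_j$ with response window $[a_j,b_j]$, $X_k^{\psi_j}=\mathbf 1[\exists m\ge k:\ t_m-t_k\in[a_j,b_j]\ \land\ \mathbf e,m\models\operatorname{resp}(\psi_j)]$. An obligation for $\psi_j$ is generated at $k$ if $\mathbf e,k\models\operatorname{trig}(\psi_j)$; it is completed at the first event index whose timestamp exceeds $t_k+H(\psi_j)$. Activation history and origin-version semantics. An activation history consists of a finite or infinite sequence of versions $\psi_0,\psi_1,\ldots$ and strictly increasing activation indices $0=n_0<n_1<\cdots$ in $\mathbb N$; if the sequence is finite with last version $\psi_j$, then $n_{j+1}:=\infty$. Version $\psi_j$ is active at event indices $n$ with $n_j\le n<n_{j+1}$.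 Origin-version semantics: the obligation with origin index $k$ is assigned the version $\psi_j$ with $n_j\le k<n_{j+1}$, and its trigger, response, interval and completion are evaluated with that $\psi_j$, even if later versions become active before it completes. *)

theory Defs
  imports Complex_Main "HOL-Library.Extended_Nat"
begin

type_synonym 'p timed_stream = "nat \<Rightarrow> real \<times> 'p set"

abbreviation timestamp :: "'p timed_stream \<Rightarrow> nat \<Rightarrow> real" where
  "timestamp e n \<equiv> fst (e n)"

abbreviation valuation :: "'p timed_stream \<Rightarrow> nat \<Rightarrow> 'p set" where
  "valuation e n \<equiv> snd (e n)"

definition is_timed_stream :: "'p set \<Rightarrow> 'p timed_stream \<Rightarrow> bool" where
  "is_timed_stream AP e \<longleftrightarrow>
     (\<forall>n. 0 \<le> timestamp e n \<and> valuation e n \<subseteq> AP \<and> timestamp e n \<le> timestamp e (Suc n)) \<and>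
     filterlim (timestamp e) at_top sequentially"

text \<open>The datatype is raw syntax: it does not restrict atoms or interval bounds. The set
  \<open>Formulas AP\<close> below carves out the formulas over \<open>AP\<close> with intervals \<open>0 \<le> a \<le> b\<close>.\<close>

datatype 'p formula =
    Atom 'p
  | Top
  | Bot
  | Neg "'p formula"
  | And "'p formula" "'p formula"
  | Or "'p formula" "'p formula"
  | Box real real "'p formula"
  | Dia real real "'p formula"

inductive_set Formulas :: "'p set \<Rightarrow> 'p formula set" for AP :: "'p set" where
  "p \<in> AP \<Longrightarrow> Atom p \<in> Formulas AP"
| "Top \<in> Formulas AP"
| "Bot \<in> Formulas AP"
| "f \<in> Formulas AP \<Longrightarrow> Neg f \<in> Formulas AP"
| "f \<in> Formulas AP \<Longrightarrow> g \<in> Formulas AP \<Longrightarrow> And f g \<in> Formulas AP"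
| "f \<in> Formulas AP \<Longrightarrow> g \<in> Formulas AP \<Longrightarrow> Or f g \<in> Formulas AP"
| "f \<in> Formulas AP \<Longrightarrow> 0 \<le> a \<Longrightarrow> a \<le> b \<Longrightarrow> Box a b f \<in> Formulas AP"
| "f \<in> Formulas AP \<Longrightarrow> 0 \<le> a \<Longrightarrow> a \<le> b \<Longrightarrow> Dia a b f \<in> Formulas AP"

primrec sat :: "'p timed_stream \<Rightarrow> nat \<Rightarrow> 'p formula \<Rightarrow> bool" where
  "sat e n (Atom p) \<longleftrightarrow> p \<in> valuation e n"
| "sat e n Top \<longleftrightarrow> True"
| "sat e n Bot \<longleftrightarrow> False"
| "sat e n (Neg f) \<longleftrightarrow> \<not> sat e n f"
| "sat e n (And f g) \<longleftrightarrow> sat e n f \<and> sat e n g"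
| "sat e n (Or f g) \<longleftrightarrow> sat e n f \<or> sat e n g"
| "sat e n (Box a b f) \<longleftrightarrow> (\<forall>m\<ge>n. timestamp e m - timestamp e n \<in> {a..b} \<longrightarrow> sat e m f)"
| "sat e n (Dia a b f) \<longleftrightarrow> (\<exists>m\<ge>n. timestamp e m - timestamp e n \<in> {a..b} \<and> sat e m f)"

primrec hzn :: "'p formula \<Rightarrow> real" where
  "hzn (Atom p) = 0"
| "hzn Top = 0"
| "hzn Bot = 0"
| "hzn (Neg f) = hzn f"
| "hzn (And f g) = max (hzn f) (hzn g)"
| "hzn (Or f g) = max (hzn f) (hzn g)"
| "hzn (Box a b f) = b + hzn f"
| "hzn (Dia a b f) = b + hzn f"

definition param_domain :: "(real \<times> real \<times> real) set" where
  "param_domain = {(l, a, b). l \<in> {0..1} \<and> 0 \<le> a \<and> a \<le> b}"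

record 'p spec =
  trig_core  :: "'p formula"
  trig_adapt :: "'p formula"
  resp_core  :: "'p formula"
  resp_adapt :: "'p formula"
  lam :: real
  lo  :: real
  hi  :: real

definition Specs :: "'p set \<Rightarrow> (real \<times> real \<times> real) set \<Rightarrow> 'p spec set" where
  "Specs AP A_par = {s.
     trig_core s \<in> Formulas AP \<and> trig_adapt s \<in> Formulas AP \<and>
     resp_core s \<in> Formulas AP \<and> resp_adapt s \<in> Formulas AP \<and>
     (lam s, lo s, hi s) \<in> A_par}"

definition trig :: "'p spec \<Rightarrow> 'p formula" where
  "trig s = Or (trig_core s) (trig_adapt s)"

definition resp :: "'p spec \<Rightarrow> 'p formula" where
  "resp s = And (resp_core s) (resp_adapt s)"

definition obs_horizon :: "'p spec \<Rightarrow> real" where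
  "obs_horizon s = max (hzn (trig s)) (hi s + hzn (resp s))"

definition outcome :: "'p timed_stream \<Rightarrow> 'p spec \<Rightarrow> nat \<Rightarrow> nat" where
  "outcome e s k = of_bool (\<exists>m\<ge>k. timestamp e m - timestamp e k \<in> {lo s..hi s} \<and> sat e m (resp s))"

definition completion_index :: "'p timed_stream \<Rightarrow> 'p spec \<Rightarrow> nat \<Rightarrow> nat" where
  "completion_index e s k = (LEAST m. k \<le> m \<and> timestamp e m > timestamp e k + obs_horizon s)"

text \<open>On a non-Zeno stream the minimum is taken over a nonempty set.\<close>

lemma completion_index_least:
  assumes "is_timed_stream AP e"
  shows "k \<le> completion_index e s k"
    and "timestamp e (completion_index e s k) > timestamp e k + obs_horizon s"
    and "\<And>m. k \<le> m \<Longrightarrow> timestamp e m > timestamp e k + obs_horizon s \<Longrightarrow> completion_index e s k \<le> m"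
proof -
  let ?P = "\<lambda>m. k \<le> m \<and> timestamp e m > timestamp e k + obs_horizon s"
  have "filterlim (timestamp e) at_top sequentially"
    using assms by (simp add: is_timed_stream_def)
  then have "eventually (\<lambda>m. timestamp e m > timestamp e k + obs_horizon s) sequentially"
    by (simp add: filterlim_at_top_dense)
  then have "eventually ?P sequentially"
    using eventually_ge_at_top[of k] by eventually_elim simp
  then obtain m where "?P m"
    using eventually_happens'[OF sequentially_bot] by blast
  then have "?P (completion_index e s k)"
    unfolding completion_index_def by (rule LeastI)
  then show "k \<le> completion_index e s k"
    and "timestamp e (completion_index e s k) > timestamp e k + obs_horizon s"
    by auto
  show "completion_index e s k \<le> m" if "k \<le> m" "timestamp e m > timestamp e k + obs_horizon s" for m
    unfolding completion_index_def using that by (intro Least_le) simp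
qed

text \<open>A finite or infinite history: the versions are those with index \<open>j\<close> such that
  \<open>enat j < num_versions h\<close>; the values of \<open>version\<close> and \<open>act_index\<close> at other indices are
  irrelevant.\<close>

record 'p history =
  num_versions :: enat
  version      :: "nat \<Rightarrow> 'p spec"
  act_index    :: "nat \<Rightarrow> nat"

definition activation_history ::
    "'p set \<Rightarrow> (real \<times> real \<times> real) set \<Rightarrow> 'p history \<Rightarrow> bool" where
  "activation_history AP A_par h \<longleftrightarrow>
     0 < num_versions h \<and>
     (\<forall>j. enat j < num_versions h \<longrightarrow> version h j \<in> Specs AP A_par) \<and>
     act_index h 0 = 0 \<and>
     (\<forall>j. enat (Suc j) < num_versions h \<longrightarrow> act_index h j < act_index h (Suc j))"

text \<open>The activation index \<open>n\<^sub>j\<close>, extended by \<open>n\<^sub>j = \<infinity>\<close> past the last version.\<close>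

definition act_bound :: "'p history \<Rightarrow> nat \<Rightarrow> enat" where
  "act_bound h j = (if enat j < num_versions h then enat (act_index h j) else \<infinity>)"

definition active :: "'p history \<Rightarrow> nat \<Rightarrow> nat \<Rightarrow> bool" where
  "active h j n \<longleftrightarrow>
     enat j < num_versions h \<and> act_bound h j \<le> enat n \<and> enat n < act_bound h (Suc j)"

text \<open>Origin-version semantics: the obligation originating at \<open>k\<close> is evaluated throughout with
  the version active at \<open>k\<close>.\<close>

definition assigned_version :: "'p history \<Rightarrow> nat \<Rightarrow> 'p spec" where
  "assigned_version h k = version h (THE j. active h j k)"

definition obl_triggered :: "'p timed_stream \<Rightarrow> 'p history \<Rightarrow> nat \<Rightarrow> bool" where
  "obl_triggered e h k \<longleftrightarrow> sat e k (trig (assigned_version h k))"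

definition obl_outcome :: "'p timed_stream \<Rightarrow> 'p history \<Rightarrow> nat \<Rightarrow> nat" where
  "obl_outcome e h k = outcome e (assigned_version h k) k"

definition obl_completion :: "'p timed_stream \<Rightarrow> 'p history \<Rightarrow> nat \<Rightarrow> nat" where
  "obl_completion e h k = completion_index e (assigned_version h k) k"

end

theory Submission imports Defs begin

text \<open>The activation indices start at 0 and increase strictly, so the intervals from n_j up to
  but excluding n_{j+1}, the last of a finite history being unbounded, partition the naturals:
  \<open>ex_active\<close> gives covering, \<open>active_not_less\<close> disjointness. An
  obligation consults its history only through \<open>assigned_version\<close>, which therefore is
  the unique version active at the origin (\<open>assigned_version_eq\<close>). Later revisions
  cannot enter, and the independence claims reduce to rewriting.\<close>

lemma act_index_strict_mono:
  assumes "activation_history AP A_par h" "i < j" "enat j < num_versions h"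
  shows "act_index h i < act_index h j"
  using assms(2,3)
proof (induction j)
  case 0
  then show ?case by simp
next
  case (Suc j)
  have "enat j < num_versions h"
    using Suc.prems(2) by (rule less_trans[rotated]) simp
  moreover have "act_index h j < act_index h (Suc j)"
    using assms(1) Suc.prems(2) by (simp add: activation_history_def)
  ultimately show ?case
    using Suc.IH Suc.prems(1) by (cases "i = j") auto
qed

text \<open>Strict growth in the naturals gains at least 1 per step. This confines the versions
  started by time k to indices up to k, so a latest one exists even in an infinite history.\<close>

lemma le_act_index:
  assumes "activation_history AP A_par h" "enat j < num_versions h"
  shows "j \<le> act_index h j"
  using assms(2)
proof (induction j)
  case 0
  then show ?case by simp
next
  case (Suc j)
  have "enat j < num_versions h"
    using Suc.prems by (rule less_trans[rotated]) simp
  then show ?case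
    using Suc.IH act_index_strict_mono[OF assms(1) lessI Suc.prems] by simp
qed

text \<open>Removes \<open>enat\<close> bounds on event indices: the convention n_{j+1} =
  \<infinity> after the last version becomes a vacuous implication.\<close>

lemma active_iff:
  "active h j k \<longleftrightarrow> enat j < num_versions h \<and> act_index h j \<le> k \<and>
     (enat (Suc j) < num_versions h \<longrightarrow> k < act_index h (Suc j))"
  by (auto simp: active_def act_bound_def)

lemma active_not_less:
  assumes "activation_history AP A_par h" "active h i k" "active h j k"
  shows "\<not> i < j"
proof
  assume "i < j"
  have j: "enat j < num_versions h" "act_index h j \<le> k"
    using assms(3) by (auto simp: active_iff)
  \<comment> \<open>Since i + 1 \<le> j, version i is not the last, so its interval ends at a finite
    index, which is at most n_j \<le> k.\<close>
  have "enat (Suc i) < num_versions h"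
    using \<open>i < j\<close> j(1) by (metis Suc_leI enat_ord_simps(1) le_less_trans)
  then have "k < act_index h (Suc i)"
    using assms(2) by (auto simp: active_iff)
  moreover have "act_index h (Suc i) \<le> act_index h j"
    using \<open>i < j\<close> act_index_strict_mono[OF assms(1) _ j(1), of "Suc i"]
    by (cases "Suc i = j") auto
  ultimately show False using j(2) by simp
qed

text \<open>The active version is the latest one started by k, that is, the greatest j satisfying
  \<open>?P\<close>.\<close>

lemma ex_active:
  assumes "activation_history AP A_par h"
  shows "\<exists>j. active h j k"
proof -
  let ?P = "\<lambda>j. enat j < num_versions h \<and> act_index h j \<le> k"
  have "?P 0"
    using assms by (simp add: activation_history_def flip: zero_enat_def)
  moreover have bound: "j \<le> k" if "?P j" for j
    using le_act_index[OF assms, of j] that by simp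
  ultimately obtain j where j: "?P j" and greatest: "\<And>i. ?P i \<Longrightarrow> i \<le> j"
    using ex_has_greatest_nat[of ?P 0 id "Suc k"] by (auto simp: less_Suc_eq_le)
  \<comment> \<open>By maximality \<open>?P (Suc j)\<close> fails: either there is no next version
    or it starts after k.\<close>
  from greatest[of "Suc j"] j show ?thesis
    by (auto simp: active_iff not_le[symmetric])
qed

lemma ex1_active:
  assumes "activation_history AP A_par h"
  shows "\<exists>!j. active h j k"
  using ex_active[OF assms] active_not_less[OF assms] by (metis nat_neq_iff)

lemma assigned_version_eq:
  assumes "activation_history AP A_par h" "active h j k"
  shows "assigned_version h k = version h j"
  using the1_equality[OF ex1_active[OF assms(1)] assms(2)] by (simp add: assigned_version_def)

theorem theorem2:
  fixes AP :: "'p set"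
    and A_par :: "(real \<times> real \<times> real) set"
    and e :: "'p timed_stream"
  assumes "finite AP"
    and "A_par \<subseteq> param_domain"
    and "is_timed_stream AP e"
  shows
    "(\<forall>h j k. activation_history AP A_par h \<and> active h j k \<longrightarrow>
        (obl_triggered e h k \<longleftrightarrow> sat e k (trig (version h j))) \<and>
        obl_outcome e h k = outcome e (version h j) k \<and>
        obl_completion e h k = completion_index e (version h j) k) \<and>
     (\<forall>h h' j j' k.
        activation_history AP A_par h \<and> activation_history AP A_par h' \<and>
        active h j k \<and> active h' j' k \<and> version h j = version h' j' \<longrightarrow>
        (obl_triggered e h k \<longleftrightarrow> obl_triggered e h' k) \<and>
        obl_outcome e h k = obl_outcome e h' k \<and>
        obl_completion e h k = obl_completion e h' k) \<and>
     (\<forall>h k. activation_history AP A_par h \<longrightarrow> (\<exists>!j. active h j k)) \<and>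
     (\<forall>h j k. activation_history AP A_par h \<and> active h j k \<longrightarrow>
        assigned_version h k = version h j)"
proof (intro conjI allI impI)
  show "\<exists>!j. active h j k" if "activation_history AP A_par h" for h k
    using that by (rule ex1_active)
\<comment> \<open>In every remaining conjunct \<open>assigned_version_eq\<close> replaces the
  assigned version by \<open>version h j\<close>, so equal versions give equal results.\<close>
qed (auto simp: obl_triggered_def obl_outcome_def obl_completion_def assigned_version_eq)

end
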